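(* Let $q \in \mathbb{R}$. For every integer $p$ with $0 \le p < q$, the function $f_q : \mathbb{E} \to \mathbb{R}$, $f_q(x) := \|x\|^q$, is $p$ times differentiable on $\mathbb{E}$, and for every $x \in \mathbb{E}$ and every unit vector $h \in \mathbb{E}$ (i.e. $\|h\| = 1$), $$D^p f_q(x)[h]^p = \|x\|^{q-p}\, g_{p,q}(\tau_h(x)),$$ where $\tau_h(x) := \frac{\langle Bx, h\rangle}{\|x\|}$ if $x \ne 0$, and $\tau_h(x) := 0$ if $x = 0$.
   Context: $\mathbb{E}$ is a finite-dimensional real vector space with dual space $\mathbb{E}^*$; $\langle s, x\rangle$ denotes the value of $s \in \mathbb{E}^*$ at $x \in \mathbb{E}$. A self-adjoint positive definite operator $B : \mathbb{E} \to \mathbb{E}^*$ is fixed, and $\|x\| := \langle Bx, x\rangle^{1/2}$. $D^p f$ denotes the $p$-th derivative of $f$ (with $D^0 f = f$); $D^p f(x)$ is a symmetric $p$-multilinear form on $\mathbb{E}$, and for a $p$-multilinear form $L$ one writes $L[h]^p := L[h,\dots,h]$. The polynomials $g_{p,q} : \mathbb{R} \to \mathbb{R}$ (integer $p \ge 0$, real $q$) are defined recursively by $g_{0,q}(\tau) := 1$ and, for $p \ge 1$, $g_{p,q}(\tau) := (1-\tau^2)\, g_{p-1,q}'(\tau) + (q-p+1)\,\tau\, g_{p-1,q}(\tau)$, where the prime denotes differentiation in $\tau$. *)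

theory Defs
  imports "HOL-Analysis.Analysis" "HOL-Computational_Algebra.Polynomial"
begin

text \<open>A \<open>k\<close>-multilinear form is represented by a function on argument lists, of which only the
  values on lists of length \<open>k\<close> are relevant.\<close>

definition multilinear_form :: "nat \<Rightarrow> ('a::euclidean_space list \<Rightarrow> real) \<Rightarrow> bool" where
  "multilinear_form k L \<longleftrightarrow>
     (\<forall>us vs. length us + 1 + length vs = k \<longrightarrow> linear (\<lambda>h. L (us @ h # vs)))"

text \<open>Frechet differentiability at \<open>x\<close> of a map \<open>F\<close> from the space into its \<open>k\<close>-multilinear forms.
  The derivative, a linear map into the \<open>k\<close>-multilinear forms, is identified with a
  \<open>(k+1)\<close>-multilinear form \<open>G\<close> whose first argument is the direction of differentiation. Uniform
  convergence on \<open>k\<close>-tuples from the unit ball is convergence in the operator norm of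
  \<open>k\<close>-multilinear forms; in finite dimension the choice of the underlying norm is irrelevant.\<close>

definition has_form_derivative ::
    "nat \<Rightarrow> ('a::euclidean_space \<Rightarrow> 'a list \<Rightarrow> real) \<Rightarrow> ('a list \<Rightarrow> real) \<Rightarrow> 'a \<Rightarrow> bool" where
  "has_form_derivative k F G x \<longleftrightarrow>
     multilinear_form (Suc k) G \<and>
     uniform_limit {hs. length hs = k \<and> set hs \<subseteq> cball 0 1}
       (\<lambda>y hs. (F y hs - F x hs - G ((y - x) # hs)) / norm (y - x)) (\<lambda>_. 0) (at x)"

text \<open>By \<open>has_form_derivative_unique\<close> below, the choice only affects irrelevant values.\<close>

primrec nth_derivative :: "nat \<Rightarrow> ('a::euclidean_space \<Rightarrow> real) \<Rightarrow> 'a \<Rightarrow> 'a list \<Rightarrow> real" where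
  "nth_derivative 0 f = (\<lambda>x hs. f x)"
| "nth_derivative (Suc k) f = (\<lambda>x. SOME G. has_form_derivative k (nth_derivative k f) G x)"

definition times_differentiable :: "nat \<Rightarrow> ('a::euclidean_space \<Rightarrow> real) \<Rightarrow> bool" where
  "times_differentiable p f \<longleftrightarrow>
     (\<forall>k<p. \<forall>x. \<exists>G. has_form_derivative k (nth_derivative k f) G x)"

lemma times_differentiable_has_form_derivative:
  assumes "times_differentiable p f" "k < p"
  shows "has_form_derivative k (nth_derivative k f) (nth_derivative (Suc k) f x) x"
proof -
  have "\<exists>G. has_form_derivative k (nth_derivative k f) G x"
    using assms by (simp add: times_differentiable_def)
  then show ?thesis
    unfolding nth_derivative.simps by (rule someI_ex)
qed

lemma multilinear_form_scale:
  assumes "multilinear_form k L" "length us + length vs = k"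
  shows "L (us @ map (\<lambda>v. c v *\<^sub>R v) vs) = prod_list (map c vs) * L (us @ vs)"
  using assms(2)
proof (induction vs arbitrary: us)
  case (Cons v vs)
  have lin: "linear (\<lambda>h. L (us @ h # map (\<lambda>v. c v *\<^sub>R v) vs))"
    using assms(1) Cons.prems by (simp add: multilinear_form_def)
  have "L (us @ map (\<lambda>v. c v *\<^sub>R v) (v # vs)) = c v * L ((us @ [v]) @ map (\<lambda>v. c v *\<^sub>R v) vs)"
    using linear_scale[OF lin] by simp
  also have "\<dots> = c v * (prod_list (map c vs) * L ((us @ [v]) @ vs))"
    using Cons.IH[of "us @ [v]"] Cons.prems by simp
  finally show ?case by simp
qed simp

lemma has_derivative_of_form:
  assumes "has_form_derivative k F G x" "length hs = k" "set hs \<subseteq> cball 0 1"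
  shows "((\<lambda>y. F y hs) has_derivative (\<lambda>h. G (h # hs))) (at x)"
proof -
  have "linear (\<lambda>h. G ([] @ h # hs))"
    using assms unfolding has_form_derivative_def multilinear_form_def
    by (metis add.commute list.size(3) add_0 plus_1_eq_Suc)
  then have "bounded_linear (\<lambda>h. G (h # hs))"
    by (simp add: linear_conv_bounded_linear)
  moreover have "((\<lambda>y. (F y hs - F x hs - G ((y - x) # hs)) / norm (y - x)) \<longlongrightarrow> 0) (at x)"
    using assms tendsto_uniform_limitI[of _ _ "\<lambda>_. 0" "at x" hs]
    unfolding has_form_derivative_def by fastforce
  ultimately show ?thesis
    unfolding has_derivative_def by (simp add: divide_inverse netlimit_at mult.commute)
qed

lemma has_form_derivative_unique:
  assumes "has_form_derivative k F G x" "has_form_derivative k F G' x" "length hs = Suc k"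
  shows "G hs = G' hs"
proof -
  obtain h vs where hs: "hs = h # vs" "length vs = k"
    using assms(3) by (cases hs) auto
  define ws where "ws = map (\<lambda>v. inverse (1 + norm v) *\<^sub>R v) vs"
  have "norm v / (1 + norm v) \<le> 1" for v :: 'a
    by (subst divide_le_eq_1_pos) (auto intro: add_pos_nonneg)
  then have "inverse (1 + norm v) * norm v \<le> 1" for v :: 'a
    by (simp add: divide_inverse mult.commute)
  then have ws: "length ws = k" "set ws \<subseteq> cball 0 1"
    using hs by (auto simp: ws_def)
  have "(\<lambda>h. G (h # ws)) = (\<lambda>h. G' (h # ws))"
    using assms(1,2) ws by (blast intro: has_derivative_unique has_derivative_of_form)
  then have eq: "G ([h] @ ws) = G' ([h] @ ws)"
    by (metis append_Cons append_Nil)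
  have ml: "multilinear_form (Suc k) G" "multilinear_form (Suc k) G'"
    using assms(1,2) by (auto simp: has_form_derivative_def)
  have "prod_list (map (\<lambda>v::'a. inverse (1 + norm v)) vs) \<noteq> 0"
  proof (induction vs)
    case (Cons a vs)
    have "1 + norm a \<noteq> 0" by (smt (verit) norm_ge_zero)
    with Cons show ?case by simp
  qed simp
  then show ?thesis
    using eq multilinear_form_scale[OF ml(1), of "[h]" vs "\<lambda>v. inverse (1 + norm v)"]
      multilinear_form_scale[OF ml(2), of "[h]" vs "\<lambda>v. inverse (1 + norm v)"] hs
    by (simp add: ws_def)
qed

lemma has_form_derivative_0_iff:
  "has_form_derivative 0 (\<lambda>y _. f y) G x \<longleftrightarrow> (f has_derivative (\<lambda>h. G [h])) (at x)"
proof -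
  have "{hs::'a list. length hs = 0 \<and> set hs \<subseteq> cball 0 1} = {[]}" by auto
  moreover have "multilinear_form (Suc 0) G \<longleftrightarrow> bounded_linear (\<lambda>h. G [h])"
    by (auto simp: multilinear_form_def linear_conv_bounded_linear)
  moreover have "uniform_limit {[]} u (\<lambda>_. 0) (at x) \<longleftrightarrow> ((\<lambda>y. u y []) \<longlongrightarrow> 0) (at x)"
    for u :: "'a \<Rightarrow> 'a list \<Rightarrow> real"
    by (auto simp: uniform_limit_iff tendsto_iff)
  ultimately show ?thesis
    unfolding has_form_derivative_def has_derivative_def
    by (simp add: divide_inverse netlimit_at mult.commute)
qed

text \<open>Operators from the space to its dual have type \<open>'a \<Rightarrow> ('a \<Rightarrow>\<^sub>L real)\<close>; the value of \<open>B x\<close>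
  at \<open>y\<close> is \<open>blinfun_apply (B x) y\<close>. The norm of the type class plays no role here.\<close>

definition self_adjoint :: "('a::euclidean_space \<Rightarrow> 'a \<Rightarrow>\<^sub>L real) \<Rightarrow> bool" where
  "self_adjoint B \<longleftrightarrow> (\<forall>x y. blinfun_apply (B x) y = blinfun_apply (B y) x)"

definition positive_definite :: "('a::euclidean_space \<Rightarrow> 'a \<Rightarrow>\<^sub>L real) \<Rightarrow> bool" where
  "positive_definite B \<longleftrightarrow> (\<forall>x. x \<noteq> 0 \<longrightarrow> blinfun_apply (B x) x > 0)"

definition norm_of :: "('a::euclidean_space \<Rightarrow> 'a \<Rightarrow>\<^sub>L real) \<Rightarrow> 'a \<Rightarrow> real" where
  "norm_of B x = sqrt (blinfun_apply (B x) x)"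

definition tau :: "('a::euclidean_space \<Rightarrow> 'a \<Rightarrow>\<^sub>L real) \<Rightarrow> 'a \<Rightarrow> 'a \<Rightarrow> real" where
  "tau B h x = (if x = 0 then 0 else blinfun_apply (B x) h / norm_of B x)"

primrec g :: "nat \<Rightarrow> real \<Rightarrow> real poly" where
  "g 0 q = 1"
| "g (Suc p) q = (1 - [:0, 1:]^2) * pderiv (g p q)
                  + smult (q - real (Suc p) + 1) ([:0, 1:] * g p q)"

end

theory Submission
  imports Defs
begin

text \<open>
  Differentiating a power of the norm once along \<open>h\<close> gives
  \<open>q * norm_of B x powr (q - 2) * \<langle>B x, h\<rangle>\<close>, so by the product rule every iterated directional
  derivative is, away from the origin, a linear combination of products of a power of the norm and
  finitely many linear forms \<open>\<langle>B x, l\<rangle>\<close>, all of one common degree of homogeneity. The class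
  \<open>homogeneous_combination\<close> of such functions is closed under directional derivatives, which lower
  the degree by one. By Cauchy-Schwarz a member of degree \<open>r\<close> is bounded by a multiple of
  \<open>norm_of B x powr r\<close>. Hence for \<open>r > 1\<close> it is differentiable at the origin as well, with derivative
  zero, and this agrees with the value zero that the members of degree \<open>r - 1\<close> have there. This is
  why \<open>p < q\<close> suffices for \<open>p\<close> derivatives on the whole space.

  Two general facts turn this into a statement on derivatives as multilinear forms. Convergence of
  multilinear forms in finite dimension can be tested on tuples of basis vectors, so pointwise
  derivatives are derivatives in operator norm (\<open>has_form_derivativeI\<close>). Moreover, iterated
  directional derivatives are multilinear as soon as they exist: linearity in the newest direction
  is linearity of a Frechet derivative, and linearity in the older ones is preserved by
  differentiation (\<open>multilinear_form_iterated_derivative\<close>).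

  The formula on the diagonal is an induction on \<open>p\<close>. At a point \<open>x \<noteq> 0\<close> and for a unit
  vector \<open>h\<close>, the derivative along \<open>h\<close> of the norm is \<open>\<tau>\<close>, and that of \<open>\<tau>\<close> is
  \<open>(1 - \<tau>\<^sup>2) / norm_of B x\<close>; differentiating the formula for \<open>p\<close> along \<open>h\<close> therefore
  reproduces the recursion of the polynomials.
\<close>

section \<open>Multilinear forms and pointwise derivatives\<close>

lemma multilinear_formD:
  assumes "multilinear_form k L" "length us + 1 + length vs = k"
  shows "linear (\<lambda>h. L (us @ h # vs))"
  using assms by (simp add: multilinear_form_def)

text \<open>Expanding the arguments one after the other in the orthonormal basis, all coefficients are at
  most one in absolute value. The prefix \<open>us\<close> collects the basis vectors already chosen.\<close>

lemma multilinear_form_bound: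
  fixes L :: "'a::euclidean_space list \<Rightarrow> real"
  assumes "multilinear_form k L" "length us + length vs = k" "set vs \<subseteq> cball 0 1"
  shows "\<bar>L (us @ vs)\<bar> \<le> (\<Sum>bs | set bs \<subseteq> Basis \<and> length bs = length vs. \<bar>L (us @ bs)\<bar>)"
  using assms(2,3)
proof (induction vs arbitrary: us)
  case Nil
  have "{bs. set bs \<subseteq> (Basis::'a set) \<and> length bs = length ([]::'a list)} = {[]}" by auto
  then show ?case by simp
next
  case (Cons v vs)
  let ?T = "{bs. set bs \<subseteq> (Basis::'a set) \<and> length bs = length vs}"
  have lin: "linear (\<lambda>h. L (us @ h # vs))"
    using multilinear_formD[OF assms(1)] Cons.prems by simp
  have "L (us @ v # vs) = L (us @ (\<Sum>b\<in>Basis. (v \<bullet> b) *\<^sub>R b) # vs)"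
    by (simp add: euclidean_representation)
  also have "\<dots> = (\<Sum>b\<in>Basis. (v \<bullet> b) * L (us @ b # vs))"
    unfolding linear_sum[OF lin] linear_scale[OF lin] by simp
  finally have "\<bar>L (us @ v # vs)\<bar> \<le> (\<Sum>b\<in>Basis. \<bar>v \<bullet> b\<bar> * \<bar>L (us @ b # vs)\<bar>)"
    using sum_abs[of "\<lambda>b. (v \<bullet> b) * L (us @ b # vs)" Basis] by (simp add: abs_mult)
  also have "\<dots> \<le> (\<Sum>b\<in>Basis. \<Sum>bs\<in>?T. \<bar>L (us @ b # bs)\<bar>)"
  proof (rule sum_mono)
    fix b :: 'a assume b: "b \<in> Basis"
    have "\<bar>v \<bullet> b\<bar> \<le> 1"
      using Basis_le_norm[OF b, of v] Cons.prems by simp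
    then have "\<bar>v \<bullet> b\<bar> * \<bar>L (us @ b # vs)\<bar> \<le> \<bar>L ((us @ [b]) @ vs)\<bar>"
      by (simp add: mult_left_le_one_le)
    also have "\<dots> \<le> (\<Sum>bs\<in>?T. \<bar>L ((us @ [b]) @ bs)\<bar>)"
      using Cons.prems by (intro Cons.IH) auto
    finally show "\<bar>v \<bullet> b\<bar> * \<bar>L (us @ b # vs)\<bar> \<le> (\<Sum>bs\<in>?T. \<bar>L (us @ b # bs)\<bar>)"
      by simp
  qed
  also have "\<dots> = (\<Sum>(b, bs)\<in>Basis \<times> ?T. \<bar>L (us @ b # bs)\<bar>)"
    by (rule sum.cartesian_product)
  also have "\<dots> = (\<Sum>bs | set bs \<subseteq> Basis \<and> length bs = length (v # vs). \<bar>L (us @ bs)\<bar>)"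
    by (rule sum.reindex_bij_witness[where i = "\<lambda>bs. (hd bs, tl bs)" and j = "\<lambda>(b, bs). b # bs"])
      (auto simp: length_Suc_conv)
  finally show ?case .
qed

text \<open>For a fixed nearby point \<open>y\<close>, the difference quotient is a multilinear form in the remaining
  arguments. Its values on the unit ball are dominated by a finite sum of values on basis tuples,
  each of which tends to zero by pointwise differentiability.\<close>

lemma has_form_derivativeI:
  fixes F :: "'a::euclidean_space \<Rightarrow> 'a list \<Rightarrow> real"
  assumes F: "\<And>y. multilinear_form k (F y)" and G: "multilinear_form (Suc k) G"
    and D: "\<And>hs. length hs = k \<Longrightarrow> ((\<lambda>y. F y hs) has_derivative (\<lambda>h. G (h # hs))) (at x)"
  shows "has_form_derivative k F G x"
proof -
  define u where "u y hs = (F y hs - F x hs - G ((y - x) # hs)) / norm (y - x)" for y hs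
  define S where "S y = (\<Sum>bs | set bs \<subseteq> (Basis::'a set) \<and> length bs = k. \<bar>u y bs\<bar>)" for y
  have ml: "multilinear_form k (u y)" for y
    unfolding multilinear_form_def
  proof (intro allI impI)
    fix us vs :: "'a list" assume len: "length us + 1 + length vs = k"
    have "linear (\<lambda>h. F z (us @ h # vs))" for z
      using multilinear_formD[OF F] len by simp
    moreover have "linear (\<lambda>h. G ((y - x) # us @ h # vs))"
      using multilinear_formD[OF G, of "(y - x) # us"] len by simp
    ultimately have "linear (\<lambda>h. inverse (norm (y - x)) *\<^sub>R
        (F y (us @ h # vs) - F x (us @ h # vs) - G ((y - x) # us @ h # vs)))"
      by (intro linear_compose_scale_right linear_compose_sub)
    then show "linear (\<lambda>h. u y (us @ h # vs))"
      by (simp add: u_def divide_inverse mult.commute)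
  qed
  have lim: "((\<lambda>y. u y hs) \<longlongrightarrow> 0) (at x)" if "length hs = k" for hs
    using D[OF that] unfolding has_derivative_def u_def
    by (simp add: divide_inverse netlimit_at mult.commute)
  have "(S \<longlongrightarrow> (\<Sum>bs | set bs \<subseteq> (Basis::'a set) \<and> length bs = k. 0)) (at x)"
    unfolding S_def by (intro tendsto_sum tendsto_rabs_zero lim) auto
  then have "(S \<longlongrightarrow> 0) (at x)" by simp
  then have "uniform_limit {hs. length hs = k \<and> set hs \<subseteq> cball 0 1} u (\<lambda>_. 0) (at x)"
    unfolding uniform_limit_iff
  proof (intro allI impI)
    fix e :: real assume "e > 0"
    with \<open>(S \<longlongrightarrow> 0) (at x)\<close> have "\<forall>\<^sub>F y in at x. dist (S y) 0 < e"
      by (rule tendstoD)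
    then show "\<forall>\<^sub>F y in at x. \<forall>hs\<in>{hs. length hs = k \<and> set hs \<subseteq> cball 0 1}. dist (u y hs) 0 < e"
    proof eventually_elim
      case (elim y)
      show ?case
      proof safe
        fix hs :: "'a list" assume "k = length hs" "set hs \<subseteq> cball 0 1"
        then have "\<bar>u y hs\<bar> \<le> S y"
          using multilinear_form_bound[OF ml, of "[]" hs y] by (simp add: S_def)
        with elim show "dist (u y hs) 0 < e" by simp
      qed
    qed
  qed
  then show ?thesis
    unfolding has_form_derivative_def using G by (simp add: u_def[abs_def])
qed

lemma has_form_derivative_cong:
  assumes "\<And>y hs. length hs = k \<Longrightarrow> F y hs = F' y hs"
  shows "has_form_derivative k F G x \<longleftrightarrow> has_form_derivative k F' G x"
proof -
  have "uniform_limit {hs. length hs = k \<and> set hs \<subseteq> cball 0 1}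
       (\<lambda>y hs. (F y hs - F x hs - G ((y - x) # hs)) / norm (y - x)) (\<lambda>_. 0) (at x) \<longleftrightarrow>
     uniform_limit {hs. length hs = k \<and> set hs \<subseteq> cball 0 1}
       (\<lambda>y hs. (F' y hs - F' x hs - G ((y - x) # hs)) / norm (y - x)) (\<lambda>_. 0) (at x)"
    by (rule uniform_limit_cong') (use assms in auto)
  then show ?thesis
    unfolding has_form_derivative_def by simp
qed

section \<open>Iterated directional derivatives\<close>

text \<open>The head of the list is the direction of the last differentiation, in accordance with the
  convention that a form derivative takes the new direction as its first argument.\<close>

primrec iterated_derivative ::
    "('a::euclidean_space \<Rightarrow> real) \<Rightarrow> 'a list \<Rightarrow> 'a \<Rightarrow> real" where
  "iterated_derivative f [] = f"
| "iterated_derivative f (h # hs) = (\<lambda>x. frechet_derivative (iterated_derivative f hs) (at x) h)"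

text \<open>By induction on the number \<open>length us\<close> of differentiations performed after the one in the
  direction \<open>h\<close>: a pointwise identity between functions may be differentiated once more.\<close>

lemma multilinear_form_iterated_derivative:
  assumes "\<And>hs x. length hs < k \<Longrightarrow> iterated_derivative f hs differentiable at x"
  shows "multilinear_form k (\<lambda>hs. iterated_derivative f hs x)"
proof -
  have "linear (\<lambda>h. iterated_derivative f (us @ h # vs) x)"
    if "length us + 1 + length vs \<le> k" for us vs
    using that
  proof (induction us arbitrary: x)
    case Nil
    then have "iterated_derivative f vs differentiable at x"
      using assms by simp
    then have "linear (frechet_derivative (iterated_derivative f vs) (at x))"
      by (rule linear_frechet_derivative)
    then show ?case by simp
  next
    case (Cons u us)
    let ?D = "\<lambda>h. iterated_derivative f (us @ h # vs)"
    have IH: "linear (\<lambda>h. ?D h z)" for z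
      using Cons by simp
    have D: "(?D h has_derivative frechet_derivative (?D h) (at x)) (at x)" for h
      using assms[of "us @ h # vs" x] Cons.prems by (simp add: frechet_derivative_works)
    have add: "?D (a + b) = (\<lambda>z. ?D a z + ?D b z)" for a b
      using linear_add[OF IH] by blast
    have scale: "?D (c *\<^sub>R a) = (\<lambda>z. c * ?D a z)" for a c
      using linear_scale[OF IH] by auto
    show ?case
    proof (rule linearI)
      fix a b
      have "frechet_derivative (?D (a + b)) (at x) =
          (\<lambda>h. frechet_derivative (?D a) (at x) h + frechet_derivative (?D b) (at x) h)"
        unfolding add by (rule frechet_derivative_at[symmetric], intro has_derivative_add D)
      then show "iterated_derivative f ((u # us) @ (a + b) # vs) x =
          iterated_derivative f ((u # us) @ a # vs) x + iterated_derivative f ((u # us) @ b # vs) x"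
        by simp
    next
      fix c a
      have "frechet_derivative (?D (c *\<^sub>R a)) (at x) =
          (\<lambda>h. c * frechet_derivative (?D a) (at x) h)"
        unfolding scale by (rule frechet_derivative_at[symmetric], intro has_derivative_mult_right D)
      then show "iterated_derivative f ((u # us) @ (c *\<^sub>R a) # vs) x =
          c *\<^sub>R iterated_derivative f ((u # us) @ a # vs) x"
        by simp
    qed
  qed
  then show ?thesis by (simp add: multilinear_form_def)
qed

lemma has_form_derivative_iterated_derivative:
  assumes "\<And>hs y. length hs \<le> k \<Longrightarrow> iterated_derivative f hs differentiable at y"
  shows "has_form_derivative k (\<lambda>y hs. iterated_derivative f hs y)
    (\<lambda>hs. iterated_derivative f hs x) x"
proof (rule has_form_derivativeI)
  show "multilinear_form k (\<lambda>hs. iterated_derivative f hs y)" for y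
    using assms by (intro multilinear_form_iterated_derivative) simp
  show "multilinear_form (Suc k) (\<lambda>hs. iterated_derivative f hs x)"
    using assms by (intro multilinear_form_iterated_derivative) simp
  fix hs :: "'a list" assume "length hs = k"
  then have "iterated_derivative f hs differentiable at x"
    using assms by simp
  then show "((\<lambda>y. iterated_derivative f hs y) has_derivative
      (\<lambda>h. iterated_derivative f (h # hs) x)) (at x)"
    by (simp add: frechet_derivative_works)
qed

text \<open>The derivative chosen by \<open>nth_derivative\<close> is determined on lists of the right length, so it
  agrees there with any other form derivative.\<close>

lemma nth_derivative_eq_iterated_derivative:
  assumes "\<And>hs x. length hs < k \<Longrightarrow> iterated_derivative f hs differentiable at x"
    and "length hs = k"
  shows "nth_derivative k f x hs = iterated_derivative f hs x"
  using assms
proof (induction k arbitrary: x hs)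
  case (Suc k)
  let ?D = "\<lambda>hs. iterated_derivative f hs x"
  have "has_form_derivative k (\<lambda>y hs. iterated_derivative f hs y) ?D x"
    using Suc.prems(1) by (intro has_form_derivative_iterated_derivative) simp
  then have D: "has_form_derivative k (nth_derivative k f) ?D x"
    using has_form_derivative_cong[of k "nth_derivative k f" "\<lambda>y hs. iterated_derivative f hs y"]
      Suc by simp
  then have "\<exists>G. has_form_derivative k (nth_derivative k f) G x"
    by blast
  then have "has_form_derivative k (nth_derivative k f) (nth_derivative (Suc k) f x) x"
    unfolding nth_derivative.simps by (rule someI_ex)
  then show ?case
    using D Suc.prems(2) by (rule has_form_derivative_unique)
qed simp

lemma times_differentiableI:
  assumes "\<And>hs x. length hs < p \<Longrightarrow> iterated_derivative f hs differentiable at x"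
  shows "times_differentiable p f"
  unfolding times_differentiable_def
proof (intro allI impI)
  fix k x assume "k < p"
  then have "has_form_derivative k (\<lambda>y hs. iterated_derivative f hs y)
      (\<lambda>hs. iterated_derivative f hs x) x"
    using assms by (intro has_form_derivative_iterated_derivative) simp
  moreover have "nth_derivative k f y hs = iterated_derivative f hs y" if "length hs = k" for y hs
    using that assms \<open>k < p\<close> by (intro nth_derivative_eq_iterated_derivative) auto
  ultimately show "\<exists>G. has_form_derivative k (nth_derivative k f) G x"
    using has_form_derivative_cong[of k "nth_derivative k f" "\<lambda>y hs. iterated_derivative f hs y"]
    by auto
qed

section \<open>Functions generated by powers of the norm and linear forms\<close>

text \<open>The index \<open>r\<close> is the degree of homogeneity. Since \<open>0 powr r = 0\<close> for every \<open>r\<close>, all members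
  vanish at the origin, even those of nonpositive degree.\<close>

inductive homogeneous_combination ::
    "('a::euclidean_space \<Rightarrow> 'a \<Rightarrow>\<^sub>L real) \<Rightarrow> real \<Rightarrow> ('a \<Rightarrow> real) \<Rightarrow> bool" for B where
  powr: "homogeneous_combination B r (\<lambda>x. norm_of B x powr r)"
| form: "homogeneous_combination B r f \<Longrightarrow>
    homogeneous_combination B (r + 1) (\<lambda>x. blinfun_apply (B x) l * f x)"
| add: "homogeneous_combination B r f \<Longrightarrow> homogeneous_combination B r f' \<Longrightarrow>
    homogeneous_combination B r (\<lambda>x. f x + f' x)"
| scale: "homogeneous_combination B r f \<Longrightarrow> homogeneous_combination B r (\<lambda>x. c * f x)"

context
  fixes B :: "'a::euclidean_space \<Rightarrow> 'a \<Rightarrow>\<^sub>L real"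
  assumes lin: "linear B" and sa: "self_adjoint B" and pd: "positive_definite B"
begin

lemma norm_of_pos: "x \<noteq> 0 \<Longrightarrow> norm_of B x > 0"
  using pd by (simp add: norm_of_def positive_definite_def)

lemma norm_of_0 [simp]: "norm_of B 0 = 0"
  by (simp add: norm_of_def)

lemma form_commute: "blinfun_apply (B x) y = blinfun_apply (B y) x"
  using sa by (simp add: self_adjoint_def)

lemma form_nonneg: "blinfun_apply (B x) x \<ge> 0"
  using pd unfolding positive_definite_def
  by (cases "x = 0") (auto simp: linear_0[OF lin] intro: less_imp_le)

lemma norm_of_square: "norm_of B x ^ 2 = blinfun_apply (B x) x"
  using form_nonneg by (simp add: norm_of_def)

lemma bounded_linear_operator: "bounded_linear B"
  using lin by (simp add: linear_conv_bounded_linear)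

lemma has_derivative_form:
  "((\<lambda>x. blinfun_apply (B x) l) has_derivative (\<lambda>h. blinfun_apply (B h) l)) F"
  using bounded_linear_compose[OF blinfun.bounded_linear_left bounded_linear_operator]
  by (rule bounded_linear_imp_has_derivative)

lemma has_derivative_norm_of:
  assumes "x \<noteq> 0"
  shows "(norm_of B has_derivative (\<lambda>h. blinfun_apply (B x) h / norm_of B x)) (at x)"
proof -
  have "((\<lambda>x. blinfun_apply (B x) x) has_derivative
      (\<lambda>h. blinfun_apply (B x) h + blinfun_apply (B h) x)) (at x)"
    by (intro blinfun.FDERIV bounded_linear_imp_has_derivative[OF bounded_linear_operator]
        has_derivative_ident)
  moreover have "blinfun_apply (B x) x > 0"
    using assms pd by (simp add: positive_definite_def)
  ultimately have "((\<lambda>x. sqrt (blinfun_apply (B x) x)) has_derivative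
      (\<lambda>h. (blinfun_apply (B x) h + blinfun_apply (B h) x) * (inverse (sqrt (blinfun_apply (B x) x)) / 2)))
      (at x)"
    by (intro has_derivative_real_sqrt) (auto simp: mult.commute)
  moreover have "(blinfun_apply (B x) h + blinfun_apply (B h) x) * (inverse (sqrt (blinfun_apply (B x) x)) / 2)
      = blinfun_apply (B x) h / sqrt (blinfun_apply (B x) x)" for h
    unfolding form_commute[of h x] by (simp add: inverse_eq_divide)
  ultimately show ?thesis
    unfolding norm_of_def[abs_def] by simp
qed

text \<open>The exponent \<open>r - 2\<close> displays the derivative as a linear form times a power of the norm, the
  shape that \<open>homogeneous_combination\<close> is generated by.\<close>

lemma has_derivative_norm_of_powr:
  assumes "x \<noteq> 0"
  shows "((\<lambda>x. norm_of B x powr r) has_derivative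
    (\<lambda>h. r * (blinfun_apply (B x) h * norm_of B x powr (r - 2)))) (at x)"
proof -
  have n: "norm_of B x > 0"
    using assms by (rule norm_of_pos)
  have "((\<lambda>x. norm_of B x powr r) has_derivative
      (\<lambda>h. (blinfun_apply (B x) h / norm_of B x) * (r * norm_of B x powr (r - 1)))) (at x)"
    using DERIV_compose_FDERIV[OF has_real_derivative_powr[OF n] has_derivative_norm_of[OF assms]] .
  moreover have "norm_of B x powr (r - 1) = norm_of B x * norm_of B x powr (r - 2)"
    using n powr_add[of "norm_of B x" 1 "r - 2"] by simp
  ultimately show ?thesis
    using n by (simp add: field_simps)
qed

lemma norm_of_bounded_by_norm: "\<exists>C>0. \<forall>x. norm_of B x \<le> C * norm x"
proof -
  obtain K where K: "K > 0" "\<And>x. norm (B x) \<le> norm x * K"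
    using bounded_linear.pos_bounded[OF bounded_linear_operator] by blast
  have "norm_of B x \<le> sqrt K * norm x" for x
  proof -
    have "blinfun_apply (B x) x \<le> norm (B x) * norm x"
      using norm_blinfun[of "B x" x] by simp
    also have "\<dots> \<le> (norm x * K) * norm x"
      by (intro mult_right_mono K) simp
    finally have "norm_of B x \<le> sqrt (K * norm x ^ 2)"
      by (simp add: norm_of_def power2_eq_square mult_ac)
    then show ?thesis by (simp add: real_sqrt_mult)
  qed
  then show ?thesis using K(1) by (intro exI[of _ "sqrt K"]) auto
qed

text \<open>The usual argument, by evaluating the quadratic form at \<open>\<langle>B x, y\<rangle> x - \<langle>B x, x\<rangle> y\<close>.\<close>

lemma form_Cauchy_Schwarz: "\<bar>blinfun_apply (B x) y\<bar> \<le> norm_of B x * norm_of B y"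
proof (cases "x = 0")
  case True
  then show ?thesis by (simp add: linear_0[OF lin])
next
  case False
  let ?a = "blinfun_apply (B x) x" and ?b = "blinfun_apply (B x) y" and ?c = "blinfun_apply (B y) y"
  have a: "?a > 0"
    using False pd by (simp add: positive_definite_def)
  have "0 \<le> blinfun_apply (B (?b *\<^sub>R x - ?a *\<^sub>R y)) (?b *\<^sub>R x - ?a *\<^sub>R y)"
    by (rule form_nonneg)
  also have "\<dots> = ?a * (?a * ?c - ?b ^ 2)"
    using form_commute[of y x]
    by (simp add: linear_diff[OF lin] linear_scale[OF lin] blinfun.diff_left blinfun.diff_right
        blinfun.scaleR_left blinfun.scaleR_right algebra_simps power2_eq_square)
  finally have "?b ^ 2 \<le> ?a * ?c"
    using a by (simp add: zero_le_mult_iff)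
  then have "?b ^ 2 \<le> (norm_of B x * norm_of B y) ^ 2"
    by (simp add: power_mult_distrib norm_of_square)
  moreover have "norm_of B x * norm_of B y \<ge> 0"
    using form_nonneg by (simp add: norm_of_def)
  ultimately show ?thesis
    by (metis abs_le_square_iff abs_of_nonneg)
qed

lemma homogeneous_combination_bound:
  assumes "homogeneous_combination B r f"
  shows "\<exists>C. \<forall>x. \<bar>f x\<bar> \<le> C * norm_of B x powr r"
  using assms
proof induction
  case (powr r)
  show ?case by (intro exI[of _ 1]) simp
next
  case (form r f l)
  then obtain C where C: "\<And>x. \<bar>f x\<bar> \<le> C * norm_of B x powr r" by blast
  have "\<bar>blinfun_apply (B x) l * f x\<bar> \<le> norm_of B l * C * norm_of B x powr (r + 1)" for x
  proof (cases "x = 0")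
    case False
    have "\<bar>blinfun_apply (B x) l * f x\<bar> \<le>
        (norm_of B x * norm_of B l) * (C * norm_of B x powr r)"
      unfolding abs_mult using form_nonneg
      by (intro mult_mono form_Cauchy_Schwarz C) (auto simp: norm_of_def)
    also have "\<dots> = norm_of B l * C * norm_of B x powr (r + 1)"
      using norm_of_pos[OF False] by (simp add: powr_add)
    finally show ?thesis .
  qed (simp add: linear_0[OF lin])
  then show ?case by blast
next
  case (add r f f')
  then obtain C C' where "\<And>x. \<bar>f x\<bar> \<le> C * norm_of B x powr r"
    "\<And>x. \<bar>f' x\<bar> \<le> C' * norm_of B x powr r" by blast
  then have "\<bar>f x + f' x\<bar> \<le> (C + C') * norm_of B x powr r" for x
    unfolding distrib_right by (intro order_trans[OF abs_triangle_ineq] add_mono)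
  then show ?case by blast
next
  case (scale r f c)
  then obtain C where C: "\<And>x. \<bar>f x\<bar> \<le> C * norm_of B x powr r" by blast
  have "\<bar>c * f x\<bar> \<le> (\<bar>c\<bar> * C) * norm_of B x powr r" for x
    using mult_left_mono[OF C[of x], of "\<bar>c\<bar>"] by (simp add: abs_mult mult.assoc)
  then show ?case by blast
qed

lemma homogeneous_combination_0:
  assumes "homogeneous_combination B r f"
  shows "f 0 = 0"
proof -
  obtain C where "\<And>x. \<bar>f x\<bar> \<le> C * norm_of B x powr r"
    using homogeneous_combination_bound[OF assms] by blast
  from this[of 0] show ?thesis by simp
qed

text \<open>The function is of order \<open>norm x powr r\<close> with \<open>r > 1\<close>, hence \<open>o(norm x)\<close>.\<close>

lemma homogeneous_combination_has_derivative_0: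
  assumes "homogeneous_combination B r f" "r > 1"
  shows "(f has_derivative (\<lambda>h. 0)) (at 0)"
proof -
  obtain C where C: "\<And>x. \<bar>f x\<bar> \<le> C * norm_of B x powr r"
    using homogeneous_combination_bound[OF assms(1)] by blast
  obtain K where K: "K > 0" "\<And>x. norm_of B x \<le> K * norm x"
    using norm_of_bounded_by_norm by blast
  have bound: "norm (f y / norm y) \<le> \<bar>C\<bar> * K powr r * norm y powr (r - 1)" for y
  proof (cases "y = 0")
    case False
    have "\<bar>f y\<bar> \<le> \<bar>C\<bar> * norm_of B y powr r"
      using C[of y] by (rule order_trans) (simp add: mult_right_mono)
    also have "\<dots> \<le> \<bar>C\<bar> * (K * norm y) powr r"
      using K assms(2) form_nonneg by (intro mult_left_mono powr_mono2) (auto simp: norm_of_def)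
    also have "\<dots> = \<bar>C\<bar> * K powr r * norm y powr (r - 1) * norm y"
      using K(1) False by (simp add: powr_mult powr_diff)
    finally show ?thesis
      using False by (simp add: field_simps)
  qed simp
  have "((\<lambda>y::'a. norm y powr (r - 1)) \<longlongrightarrow> 0) (at 0)"
    using assms(2) by (intro tendsto_zero_powrI[where b = "r - 1"] tendsto_norm_zero tendsto_const) auto
  then have "((\<lambda>y::'a. \<bar>C\<bar> * K powr r * norm y powr (r - 1)) \<longlongrightarrow> 0) (at 0)"
    by (rule tendsto_mult_right_zero)
  then have "((\<lambda>y. f y / norm y) \<longlongrightarrow> 0) (at 0)"
    by (rule Lim_null_comparison[rotated]) (use bound in \<open>auto intro: always_eventually\<close>)
  then show ?thesis
    using homogeneous_combination_0[OF assms(1)]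
    by (simp add: has_derivative_def netlimit_at divide_inverse mult.commute)
qed

text \<open>The derivative is produced together with its membership in the class, by structural induction.
  It is a function on the whole space although it is a derivative only off the origin; the value at
  the origin is compared with the derivative there in the next lemma.\<close>

lemma homogeneous_combination_has_derivative:
  assumes "homogeneous_combination B r f"
  shows "\<exists>f'. (\<forall>x. x \<noteq> 0 \<longrightarrow> (f has_derivative f' x) (at x)) \<and>
    (\<forall>h. homogeneous_combination B (r - 1) (\<lambda>x. f' x h))"
  using assms
proof induction
  case (powr r)
  have "homogeneous_combination B (r - 1)
      (\<lambda>x. r * (blinfun_apply (B x) h * norm_of B x powr (r - 2)))" for h
    using homogeneous_combination.form[OF homogeneous_combination.powr[of B "r - 2"], of h]
    by (intro homogeneous_combination.scale) simp
  then show ?case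
    using has_derivative_norm_of_powr[of _ r]
    by (intro exI[of _ "\<lambda>x h. r * (blinfun_apply (B x) h * norm_of B x powr (r - 2))"]) blast
next
  case (form r f l)
  then obtain f' where f': "\<And>x. x \<noteq> 0 \<Longrightarrow> (f has_derivative f' x) (at x)"
    "\<And>h. homogeneous_combination B (r - 1) (\<lambda>x. f' x h)" by blast
  let ?D = "\<lambda>x h. blinfun_apply (B x) l * f' x h + blinfun_apply (B h) l * f x"
  have "((\<lambda>x. blinfun_apply (B x) l * f x) has_derivative ?D x) (at x)" if "x \<noteq> 0" for x
    by (intro has_derivative_mult has_derivative_form f' that)
  moreover have "homogeneous_combination B (r + 1 - 1) (\<lambda>x. ?D x h)" for h
    using homogeneous_combination.form[OF f'(2), of l h] form.hyps
    by (intro homogeneous_combination.add homogeneous_combination.scale) auto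
  ultimately show ?case by (intro exI[of _ ?D]) blast
next
  case (add r f u)
  then obtain f' u' where "\<And>x. x \<noteq> 0 \<Longrightarrow> (f has_derivative f' x) (at x)"
    "\<And>h. homogeneous_combination B (r - 1) (\<lambda>x. f' x h)"
    "\<And>x. x \<noteq> 0 \<Longrightarrow> (u has_derivative u' x) (at x)"
    "\<And>h. homogeneous_combination B (r - 1) (\<lambda>x. u' x h)" by blast
  then show ?case
    by (intro exI[of _ "\<lambda>x h. f' x h + u' x h"])
      (auto intro: has_derivative_add homogeneous_combination.add)
next
  case (scale r f c)
  then obtain f' where "\<And>x. x \<noteq> 0 \<Longrightarrow> (f has_derivative f' x) (at x)"
    "\<And>h. homogeneous_combination B (r - 1) (\<lambda>x. f' x h)" by blast
  then show ?case
    by (intro exI[of _ "\<lambda>x h. c * f' x h"])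
      (auto intro: has_derivative_mult_right homogeneous_combination.scale)
qed

lemma homogeneous_combination_frechet_derivative:
  assumes "homogeneous_combination B r f" "r > 1"
  shows "f differentiable at x"
    and "homogeneous_combination B (r - 1) (\<lambda>x. frechet_derivative f (at x) h)"
proof -
  obtain f' where f': "\<forall>x. x \<noteq> 0 \<longrightarrow> (f has_derivative f' x) (at x)"
    "\<forall>h. homogeneous_combination B (r - 1) (\<lambda>x. f' x h)"
    using homogeneous_combination_has_derivative[OF assms(1)] by (elim exE conjE)
  \<comment> \<open>The formal derivative and the derivative from the growth bound both vanish at the origin.\<close>
  have "f' 0 h = 0" for h
    using homogeneous_combination_0[OF f'(2)[rule_format]] .
  then have "f' 0 = (\<lambda>h. 0)"
    by (rule ext)
  then have D: "(f has_derivative f' x) (at x)" for x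
    using homogeneous_combination_has_derivative_0[OF assms] f'(1) by (cases "x = 0") auto
  then show "f differentiable at x"
    by (auto simp: differentiable_def)
  have "frechet_derivative f (at x) = f' x" for x
    using frechet_derivative_at[OF D] by simp
  then show "homogeneous_combination B (r - 1) (\<lambda>x. frechet_derivative f (at x) h)"
    using f'(2) by simp
qed

text \<open>The last differentiation starts from degree \<open>q - length hs + 1 > 1\<close>, which is what
  differentiability at the origin requires.\<close>

lemma homogeneous_combination_iterated_derivative:
  assumes "real (length hs) < q"
  shows "homogeneous_combination B (q - real (length hs))
    (iterated_derivative (\<lambda>x. norm_of B x powr q) hs)"
  using assms
proof (induction hs)
  case Nil
  show ?case using homogeneous_combination.powr[of B q] by simp
next
  case (Cons h hs)
  have "homogeneous_combination B (q - real (length hs) - 1) (\<lambda>x.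
      frechet_derivative (iterated_derivative (\<lambda>x. norm_of B x powr q) hs) (at x) h)"
    using Cons by (intro homogeneous_combination_frechet_derivative) auto
  moreover have "q - real (length hs) - 1 = q - real (length (h # hs))" by simp
  ultimately show ?case by simp
qed

lemma iterated_derivative_norm_of_powr_differentiable:
  assumes "real (length hs) + 1 < q"
  shows "iterated_derivative (\<lambda>x. norm_of B x powr q) hs differentiable at x"
  using assms
  by (intro homogeneous_combination_frechet_derivative(1)[of "q - real (length hs)"]
      homogeneous_combination_iterated_derivative) auto

lemma has_derivative_tau:
  assumes "x \<noteq> 0"
  shows "(tau B h has_derivative (\<lambda>v. blinfun_apply (B v) h / norm_of B x -
    blinfun_apply (B x) h * blinfun_apply (B x) v / norm_of B x ^ 3)) (at x)"
proof -
  have n: "norm_of B x > 0"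
    using assms by (rule norm_of_pos)
  have "((\<lambda>x. blinfun_apply (B x) h / norm_of B x) has_derivative
     (\<lambda>v. blinfun_apply (B v) h / norm_of B x -
      blinfun_apply (B x) h * blinfun_apply (B x) v / norm_of B x ^ 3)) (at x)"
    by (rule has_derivative_eq_rhs[OF has_derivative_divide'[OF has_derivative_form
            has_derivative_norm_of[OF assms]]])
      (use n in \<open>auto simp: field_simps power3_eq_cube\<close>)
  then show ?thesis
    by (rule has_derivative_transform_within_open[of _ _ _ _ "- {0}"])
      (use assms in \<open>auto simp: tau_def\<close>)
qed

text \<open>At the origin both sides vanish. Elsewhere the induction hypothesis holds at all points, so the
  two sides for \<open>p\<close> are equal as functions and may be differentiated along \<open>h\<close>.\<close>

lemma iterated_derivative_norm_of_powr_diagonal: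
  assumes "norm_of B h = 1" "real p < q"
  shows "iterated_derivative (\<lambda>x. norm_of B x powr q) (replicate p h) x =
    norm_of B x powr (q - real p) * poly (g p q) (tau B h x)"
  using assms(2)
proof (induction p arbitrary: x)
  case (Suc p)
  let ?F = "\<lambda>p. iterated_derivative (\<lambda>x. norm_of B x powr q) (replicate p h)"
  show ?case
  proof (cases "x = 0")
    case True
    have "homogeneous_combination B (q - real (Suc p)) (?F (Suc p))"
      using homogeneous_combination_iterated_derivative[of "replicate (Suc p) h" q] Suc.prems by simp
    with True show ?thesis
      using homogeneous_combination_0 by fastforce
  next
    case False
    define n where "n = norm_of B x"
    define t where "t = tau B h x"
    have n: "n > 0"
      using False by (simp add: n_def norm_of_pos)
    have Bxh: "blinfun_apply (B x) h = n * t"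
      using False n by (simp add: t_def tau_def n_def)
    have Bhh: "blinfun_apply (B h) h = 1"
      using norm_of_square[of h] assms(1) by simp
    have F: "?F p = (\<lambda>x. norm_of B x powr (q - real p) * poly (g p q) (tau B h x))"
      using Suc by auto
    have "(?F p has_derivative (\<lambda>v. norm_of B x powr (q - real p) *
          ((blinfun_apply (B v) h / norm_of B x -
            blinfun_apply (B x) h * blinfun_apply (B x) v / norm_of B x ^ 3) *
            poly (pderiv (g p q)) (tau B h x)) +
        (q - real p) * (blinfun_apply (B x) v * norm_of B x powr (q - real p - 2)) *
          poly (g p q) (tau B h x))) (at x)"
      unfolding F
      by (intro has_derivative_mult has_derivative_norm_of_powr False
          DERIV_compose_FDERIV[OF poly_DERIV has_derivative_tau])
    then have "?F (Suc p) x = n powr (q - real p) *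
          ((1 / n - (n * t) * (n * t) / n ^ 3) * poly (pderiv (g p q)) t) +
        (q - real p) * ((n * t) * n powr (q - real p - 2)) * poly (g p q) t"
      by (simp add: frechet_derivative_at[symmetric] Bxh Bhh flip: n_def t_def)
    also have "n powr (q - real p) = n * n powr (q - real (Suc p))"
      using n powr_add[of n 1 "q - real (Suc p)"] by simp
    also have "n powr (q - real p - 2) = n powr (q - real (Suc p)) / n"
      using n powr_diff[of n "q - real (Suc p)" 1] by (simp add: algebra_simps)
    also have "n * n powr (q - real (Suc p)) *
          ((1 / n - (n * t) * (n * t) / n ^ 3) * poly (pderiv (g p q)) t) +
        (q - real p) * ((n * t) * (n powr (q - real (Suc p)) / n)) * poly (g p q) t =
        n powr (q - real (Suc p)) * ((1 - t ^ 2) * poly (pderiv (g p q)) t +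
          (q - real p) * (t * poly (g p q) t))"
      using n by (simp add: field_simps power2_eq_square power3_eq_cube)
    also have "\<dots> = n powr (q - real (Suc p)) * poly (g (Suc p) q) t"
      by simp
    finally show ?thesis by (simp add: n_def t_def)
  qed
qed simp

end

theorem theorem3p1:
  fixes B :: "'a::euclidean_space \<Rightarrow> 'a \<Rightarrow>\<^sub>L real" and q :: real and p :: nat
  assumes "linear B" and "self_adjoint B" and "positive_definite B"
    and "real p < q"
  shows "times_differentiable p (\<lambda>x. norm_of B x powr q) \<and>
    (\<forall>x h. norm_of B h = 1 \<longrightarrow>
      nth_derivative p (\<lambda>x. norm_of B x powr q) x (replicate p h) =
        norm_of B x powr (q - real p) * poly (g p q) (tau B h x))"
proof -
  let ?f = "\<lambda>x. norm_of B x powr q"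
  have D: "iterated_derivative ?f hs differentiable at x" if "length hs < p" for hs x
  proof -
    have "real (length hs) + 1 < q"
      using that assms(4) by linarith
    then show ?thesis
      by (rule iterated_derivative_norm_of_powr_differentiable[OF assms(1-3)])
  qed
  show ?thesis
  proof (intro conjI allI impI)
    show "times_differentiable p ?f"
      using D by (rule times_differentiableI)
    fix x h assume "norm_of B h = 1"
    then have "iterated_derivative ?f (replicate p h) x =
        norm_of B x powr (q - real p) * poly (g p q) (tau B h x)"
      using iterated_derivative_norm_of_powr_diagonal[OF assms(1-3) _ assms(4)] by blast
    moreover have "nth_derivative p ?f x (replicate p h) = iterated_derivative ?f (replicate p h) x"
      using D by (rule nth_derivative_eq_iterated_derivative) simp_all
    ultimately show "nth_derivative p ?f x (replicate p h) =
        norm_of B x powr (q - real p) * poly (g p q) (tau B h x)"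
      by simp
  qed
qed

end
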